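(* Suppose that $A$ and $B$ are groups that are elementarily equivalent in the language of groups $\{\cdot\}$ and that $A$ is dual surjunctive. Then $B$ is dual surjunctive.
   Context: Two groups are elementarily equivalent if they satisfy the same first-order sentences in the language $\{\cdot\}$. For a group $G$ and a finite set $\Sigma$, $\Sigma^G$ carries the product topology ($\Sigma$ discrete) and the action $(g\cdot f)(x)=f(g^{-1}x)$. A cellular automaton $T\colon \Sigma^G\to \Sigma^G$ is a continuous $G$-equivariant map. For $c,d\in \Sigma^G$ write $c\sim d$ if $\{g\in G: c(g)\neq d(g)\}$ is finite. $T$ is post-surjective if whenever $c,e\in \Sigma^G$ and $T(c)\sim e$, there is $c'\sim c$ with $T(c')=e$. $T$ is pre-injective if $c\sim d$ and $T(c)=T(d)$ imply $c=d$. A group $G$ is dual surjunctive if for every finite set $\Sigma$, every post-surjective cellular automaton $T\colon \Sigma^G\to \Sigma^G$ is pre-injective. *)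

theory Defs
  imports "HOL-Analysis.Function_Topology" "HOL-Algebra.Group"
begin


datatype grp_term = Var nat | Mult grp_term grp_term

text \<open>The remaining connectives and the universal quantifier are definable from these.\<close>

datatype grp_formula =
    Eq grp_term grp_term
  | Neg grp_formula
  | Conj grp_formula grp_formula
  | Exists nat grp_formula

primrec term_vars :: "grp_term \<Rightarrow> nat set" where
  "term_vars (Var n) = {n}"
| "term_vars (Mult s t) = term_vars s \<union> term_vars t"

primrec free_vars :: "grp_formula \<Rightarrow> nat set" where
  "free_vars (Eq s t) = term_vars s \<union> term_vars t"
| "free_vars (Neg \<phi>) = free_vars \<phi>"
| "free_vars (Conj \<phi> \<psi>) = free_vars \<phi> \<union> free_vars \<psi>"
| "free_vars (Exists n \<phi>) = free_vars \<phi> - {n}"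

definition sentence :: "grp_formula \<Rightarrow> bool" where
  "sentence \<phi> \<longleftrightarrow> free_vars \<phi> = {}"

primrec term_val :: "('a, 'm) monoid_scheme \<Rightarrow> (nat \<Rightarrow> 'a) \<Rightarrow> grp_term \<Rightarrow> 'a" where
  "term_val G v (Var n) = v n"
| "term_val G v (Mult s t) = term_val G v s \<otimes>\<^bsub>G\<^esub> term_val G v t"

primrec satisfies :: "('a, 'm) monoid_scheme \<Rightarrow> (nat \<Rightarrow> 'a) \<Rightarrow> grp_formula \<Rightarrow> bool" where
  "satisfies G v (Eq s t) \<longleftrightarrow> term_val G v s = term_val G v t"
| "satisfies G v (Neg \<phi>) \<longleftrightarrow> \<not> satisfies G v \<phi>"
| "satisfies G v (Conj \<phi> \<psi>) \<longleftrightarrow> satisfies G v \<phi> \<and> satisfies G v \<psi>"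
| "satisfies G v (Exists n \<phi>) \<longleftrightarrow> (\<exists>a\<in>carrier G. satisfies G (v(n := a)) \<phi>)"

definition holds_in :: "('a, 'm) monoid_scheme \<Rightarrow> grp_formula \<Rightarrow> bool" where
  "holds_in G \<phi> \<longleftrightarrow> (\<forall>v. range v \<subseteq> carrier G \<longrightarrow> satisfies G v \<phi>)"

definition elementarily_equivalent ::
    "('a, 'm) monoid_scheme \<Rightarrow> ('b, 'n) monoid_scheme \<Rightarrow> bool" where
  "elementarily_equivalent G H \<longleftrightarrow> (\<forall>\<phi>. sentence \<phi> \<longrightarrow> (holds_in G \<phi> \<longleftrightarrow> holds_in H \<phi>))"



text \<open>Configurations are extensional functions on the carrier of the group; a cellular
  automaton is a HOL function of which only the values on configurations matter.\<close>

definition configs :: "('a, 'm) monoid_scheme \<Rightarrow> 's set \<Rightarrow> ('a \<Rightarrow> 's) set" where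
  "configs G \<Sigma> = carrier G \<rightarrow>\<^sub>E \<Sigma>"

definition config_topology :: "('a, 'm) monoid_scheme \<Rightarrow> 's set \<Rightarrow> ('a \<Rightarrow> 's) topology" where
  "config_topology G \<Sigma> = product_topology (\<lambda>_. discrete_topology \<Sigma>) (carrier G)"

definition shift :: "('a, 'm) monoid_scheme \<Rightarrow> 'a \<Rightarrow> ('a \<Rightarrow> 's) \<Rightarrow> ('a \<Rightarrow> 's)" where
  "shift G g f = (\<lambda>x\<in>carrier G. f (inv\<^bsub>G\<^esub> g \<otimes>\<^bsub>G\<^esub> x))"

definition cellular_automaton ::
    "('a, 'm) monoid_scheme \<Rightarrow> 's set \<Rightarrow> (('a \<Rightarrow> 's) \<Rightarrow> ('a \<Rightarrow> 's)) \<Rightarrow> bool" where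
  "cellular_automaton G \<Sigma> T \<longleftrightarrow>
     continuous_map (config_topology G \<Sigma>) (config_topology G \<Sigma>) T \<and>
     (\<forall>g\<in>carrier G. \<forall>f\<in>configs G \<Sigma>. T (shift G g f) = shift G g (T f))"

definition asymptotic :: "('a, 'm) monoid_scheme \<Rightarrow> ('a \<Rightarrow> 's) \<Rightarrow> ('a \<Rightarrow> 's) \<Rightarrow> bool" where
  "asymptotic G c d \<longleftrightarrow> finite {g \<in> carrier G. c g \<noteq> d g}"

definition post_surjective ::
    "('a, 'm) monoid_scheme \<Rightarrow> 's set \<Rightarrow> (('a \<Rightarrow> 's) \<Rightarrow> ('a \<Rightarrow> 's)) \<Rightarrow> bool" where
  "post_surjective G \<Sigma> T \<longleftrightarrow>
     (\<forall>c\<in>configs G \<Sigma>. \<forall>e\<in>configs G \<Sigma>. asymptotic G (T c) e \<longrightarrow>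
        (\<exists>c'\<in>configs G \<Sigma>. asymptotic G c' c \<and> T c' = e))"

definition pre_injective ::
    "('a, 'm) monoid_scheme \<Rightarrow> 's set \<Rightarrow> (('a \<Rightarrow> 's) \<Rightarrow> ('a \<Rightarrow> 's)) \<Rightarrow> bool" where
  "pre_injective G \<Sigma> T \<longleftrightarrow>
     (\<forall>c\<in>configs G \<Sigma>. \<forall>d\<in>configs G \<Sigma>. asymptotic G c d \<and> T c = T d \<longrightarrow> c = d)"

text \<open>HOL cannot quantify over types inside a definition, so the alphabets range over the finite
  sets of natural numbers. Every finite set is in bijection with one of these, and
  \<open>dual_surjunctive_any_alphabet\<close> below shows that nothing is lost.\<close>

definition dual_surjunctive :: "('a, 'm) monoid_scheme \<Rightarrow> bool" where
  "dual_surjunctive G \<longleftrightarrow>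
     (\<forall>(\<Sigma> :: nat set) T. finite \<Sigma> \<longrightarrow> cellular_automaton G \<Sigma> T \<longrightarrow>
        post_surjective G \<Sigma> T \<longrightarrow> pre_injective G \<Sigma> T)"

lemma topspace_config_topology: "topspace (config_topology G \<Sigma>) = configs G \<Sigma>"
  by (simp add: config_topology_def configs_def)

lemma continuous_map_relabel:
  assumes "h ` \<Sigma> \<subseteq> \<Sigma>'"
  shows "continuous_map (config_topology G \<Sigma>) (config_topology G \<Sigma>')
           (\<lambda>c. \<lambda>x\<in>carrier G. h (c x))"
  unfolding config_topology_def
proof (subst continuous_map_componentwise, intro conjI ballI)
  fix k assume k: "k \<in> carrier G"
  have "continuous_map (product_topology (\<lambda>_. discrete_topology \<Sigma>) (carrier G))
          (discrete_topology \<Sigma>') (h \<circ> (\<lambda>c. c k))"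
  proof (rule continuous_map_compose)
    show "continuous_map (product_topology (\<lambda>_. discrete_topology \<Sigma>) (carrier G))
            (discrete_topology \<Sigma>) (\<lambda>c. c k)"
      using continuous_map_product_projection[OF k, of "\<lambda>_. discrete_topology \<Sigma>"] by simp
    show "continuous_map (discrete_topology \<Sigma>) (discrete_topology \<Sigma>') h"
      using assms by (auto simp: continuous_map_def openin_discrete_topology)
  qed
  then show "continuous_map (product_topology (\<lambda>_. discrete_topology \<Sigma>) (carrier G))
          (discrete_topology \<Sigma>') (\<lambda>c. (\<lambda>x\<in>carrier G. h (c x)) k)"
    using k by (simp add: o_def)
qed auto

lemma dual_surjunctive_any_alphabet:
  fixes G :: "('a, 'm) monoid_scheme" and \<Sigma> :: "'s set"
  assumes "group G" "dual_surjunctive G" "finite \<Sigma>"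
    and T: "cellular_automaton G \<Sigma> T" and post: "post_surjective G \<Sigma> T"
  shows "pre_injective G \<Sigma> T"
proof -
  interpret group G by fact
  obtain h where h: "bij_betw h \<Sigma> {0..<card \<Sigma>}"
    using ex_bij_betw_finite_nat[OF \<open>finite \<Sigma>\<close>] by blast
  define N where "N = {0..<card \<Sigma>}"
  define k where "k = inv_into \<Sigma> h"
  have hN: "h s \<in> N" if "s \<in> \<Sigma>" for s using h that by (auto simp: bij_betw_def N_def)
  have kS: "k n \<in> \<Sigma>" if "n \<in> N" for n
    using h that unfolding k_def N_def by (metis bij_betw_def inv_into_into)
  have kh: "k (h s) = s" if "s \<in> \<Sigma>" for s
    using h that unfolding k_def by (simp add: bij_betw_inv_into_left)
  have hk: "h (k n) = n" if "n \<in> N" for n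
    using h that unfolding k_def N_def by (simp add: bij_betw_inv_into_right)
  define F :: "('a \<Rightarrow> 's) \<Rightarrow> 'a \<Rightarrow> nat" where "F = (\<lambda>c. \<lambda>x\<in>carrier G. h (c x))"
  define K :: "('a \<Rightarrow> nat) \<Rightarrow> 'a \<Rightarrow> 's" where "K = (\<lambda>c. \<lambda>x\<in>carrier G. k (c x))"
  define T' where "T' = F \<circ> T \<circ> K"
  have F: "F c \<in> configs G N" if "c \<in> configs G \<Sigma>" for c
    using that hN by (auto simp: F_def configs_def PiE_iff)
  have K: "K c \<in> configs G \<Sigma>" if "c \<in> configs G N" for c
    using that kS by (auto simp: K_def configs_def PiE_iff)
  have KF: "K (F c) = c" if "c \<in> configs G \<Sigma>" for c
    using that by (auto simp: K_def F_def configs_def kh PiE_iff extensional_def)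
  have FK: "F (K c) = c" if "c \<in> configs G N" for c
    using that by (auto simp: K_def F_def configs_def hk PiE_iff extensional_def)
  have TS: "T c \<in> configs G \<Sigma>" if "c \<in> configs G \<Sigma>" for c
    using T that unfolding cellular_automaton_def continuous_map_def topspace_config_topology
    by auto
  have sF: "F (shift G g c) = shift G g (F c)" if "g \<in> carrier G" for g c
    using that by (auto simp: F_def shift_def)
  have sK: "K (shift G g c) = shift G g (K c)" if "g \<in> carrier G" for g c
    using that by (auto simp: K_def shift_def)
  have aF: "asymptotic G (F c) (F d)" if "asymptotic G c d" for c d
    using that unfolding asymptotic_def by (rule rev_finite_subset) (auto simp: F_def)
  have aK: "asymptotic G (K c) (K d)" if "asymptotic G c d" for c d
    using that unfolding asymptotic_def by (rule rev_finite_subset) (auto simp: K_def)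
  have "cellular_automaton G N T'"
    unfolding cellular_automaton_def
  proof (intro conjI ballI)
    show "continuous_map (config_topology G N) (config_topology G N) T'"
      unfolding T'_def
    proof (intro continuous_map_compose)
      show "continuous_map (config_topology G N) (config_topology G \<Sigma>) K"
        unfolding K_def using kS by (intro continuous_map_relabel) auto
      show "continuous_map (config_topology G \<Sigma>) (config_topology G \<Sigma>) T"
        using T by (simp add: cellular_automaton_def)
      show "continuous_map (config_topology G \<Sigma>) (config_topology G N) F"
        unfolding F_def using hN by (intro continuous_map_relabel) auto
    qed
    fix g f assume "g \<in> carrier G" "f \<in> configs G N"
    then show "T' (shift G g f) = shift G g (T' f)"
      using T K by (simp add: T'_def sF sK cellular_automaton_def)
  qed
  moreover have "post_surjective G N T'"
    unfolding post_surjective_def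
  proof (intro ballI impI)
    fix c e assume c: "c \<in> configs G N" and e: "e \<in> configs G N"
      and a: "asymptotic G (T' c) e"
    have "asymptotic G (T (K c)) (K e)"
      using aK[OF a] KF[OF TS[OF K[OF c]]] by (simp add: T'_def)
    then obtain c' where c': "c' \<in> configs G \<Sigma>" "asymptotic G c' (K c)" "T c' = K e"
      using post K[OF c] K[OF e] unfolding post_surjective_def by blast
    show "\<exists>c'\<in>configs G N. asymptotic G c' c \<and> T' c' = e"
      using F[OF c'(1)] aF[OF c'(2)] FK[OF c] FK[OF e] KF[OF c'(1)] c'(3)
      by (intro bexI[of _ "F c'"]) (auto simp: T'_def)
  qed
  ultimately have pre: "pre_injective G N T'"
    using \<open>dual_surjunctive G\<close> unfolding dual_surjunctive_def N_def by blast
  show ?thesis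
    unfolding pre_injective_def
  proof (intro ballI impI, elim conjE)
    fix c d assume cd: "c \<in> configs G \<Sigma>" "d \<in> configs G \<Sigma>"
      and a: "asymptotic G c d" and eq: "T c = T d"
    have "T' (F c) = T' (F d)" using cd eq by (simp add: T'_def KF)
    then have "F c = F d"
      using pre F[OF cd(1)] F[OF cd(2)] aF[OF a] unfolding pre_injective_def by blast
    then show "c = d" using KF cd by metis
  qed
qed

end

theory Submission
  imports Defs
begin

text \<open>
  Elementary equivalence is used through existential sentences. Fix a finite set \<open>F\<close> in \<open>B\<close>. That
  the elements of \<open>F\<close> are distinct and multiply as they do is expressed by a sentence
  \<open>\<exists>x\<^sub>0 \<dots> x\<^sub>n\<^sub>-\<^sub>1. \<dots>\<close>, which therefore also holds in \<open>A\<close>; its witnesses form an injective copy of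
  \<open>F\<close> in \<open>A\<close> respecting all products that stay in \<open>F\<close>. Hence \<open>B\<close> embeds locally in \<open>A\<close>
  (\<open>elementarily_equivalent_imp_locally_embeds\<close>), and it suffices that dual surjunctivity passes
  from \<open>A\<close> to every group that embeds locally in it (\<open>dual_surjunctive_locally_embeds\<close>).

  For this, a counterexample \<open>T\<close> over \<open>B\<close> has to be described by finitely many elements of \<open>B\<close>.
  Compactness of the configuration space provides two finite sets. One is a memory set \<open>M\<close>: the
  value \<open>T c 1\<close> depends only on the restriction of \<open>c\<close> to \<open>M\<close>. The other is a set \<open>N\<close> for which
  every prescribed value of \<open>T c\<close> at the identity is realised, without altering \<open>T c\<close> elsewhere, by
  changing \<open>c\<close> on \<open>N\<close> only (\<open>post_surjective_imp_repairs_identity\<close>). Such a uniform \<open>N\<close> is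
  equivalent to post-surjectivity, because a finite discrepancy can be removed one site at a time.
  Failure of pre-injectivity is witnessed by two configurations differing on a finite set \<open>D\<close>.

  Put \<open>E = N \<union> D\<close>. A change of \<open>c\<close> on \<open>E\<close> affects \<open>T c\<close> only on \<open>E M\<^sup>-\<^sup>1\<close>, and computing
  \<open>T c\<close> there takes only the products of \<open>E M\<^sup>-\<^sup>1\<close> with \<open>M\<close>. If \<open>\<phi>\<close> preserves this finite part of the
  multiplication table, the same local rule with memory set \<open>\<phi> M\<close> defines an automaton over \<open>A\<close>
  that is post-surjective with the set \<open>\<phi> E\<close> and is not pre-injective.
\<close>

section \<open>Compactness of the space of configurations\<close>

lemma compact_config_topology:
  assumes "finite \<Sigma>"
  shows "compact_space (config_topology G \<Sigma>)"
  using assms unfolding config_topology_def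
  by (simp add: compact_space_product_topology compact_space_discrete_topology)

lemma openin_cylinder:
  assumes "finite N" "N \<subseteq> carrier G"
  shows "openin (config_topology G \<Sigma>) {d \<in> configs G \<Sigma>. \<forall>x\<in>N. d x = c x}"
proof (cases "\<forall>x\<in>N. c x \<in> \<Sigma>")
  case True
  have eq: "{d \<in> configs G \<Sigma>. \<forall>x\<in>N. d x = c x}
      = (\<Pi>\<^sub>E x\<in>carrier G. if x \<in> N then {c x} else \<Sigma>)"
    using True assms(2) by (auto simp: configs_def PiE_iff extensional_def split: if_splits)
  have "finite {x \<in> carrier G. (if x \<in> N then {c x} else \<Sigma>) \<noteq> \<Sigma>}"
    by (rule finite_subset[OF _ assms(1)]) auto
  then show ?thesis
    unfolding eq config_topology_def using True by (auto simp: openin_PiE_gen)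
next
  case False
  then have "{d \<in> configs G \<Sigma>. \<forall>x\<in>N. d x = c x} = {}"
    using assms(2) by (auto simp: configs_def PiE_iff) (metis subsetD)
  then show ?thesis by (metis openin_empty)
qed

text \<open>Compactness in the form used below: a finite set that works near each configuration can be
  chosen uniformly, as the union of the sets belonging to a finite subcover by cylinders.\<close>

lemma uniform_finite_set:
  fixes G :: "('a, 'm) monoid_scheme" and \<Sigma> :: "'s set"
  assumes "finite \<Sigma>"
    and local: "\<And>c. c \<in> configs G \<Sigma> \<Longrightarrow>
      \<exists>N\<subseteq>carrier G. finite N \<and> (\<forall>d\<in>configs G \<Sigma>. (\<forall>x\<in>N. d x = c x) \<longrightarrow> Q N d)"
    and mono: "\<And>N N' d. N \<subseteq> N' \<Longrightarrow> Q N d \<Longrightarrow> Q N' d"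
  shows "\<exists>N\<subseteq>carrier G. finite N \<and> (\<forall>d\<in>configs G \<Sigma>. Q N d)"
proof -
  define cyl where "cyl N c = {d \<in> configs G \<Sigma>. \<forall>x\<in>N. d x = c x}" for N and c :: "'a \<Rightarrow> 's"
  obtain W where W: "\<And>c. c \<in> configs G \<Sigma> \<Longrightarrow>
      W c \<subseteq> carrier G \<and> finite (W c) \<and> (\<forall>d\<in>cyl (W c) c. Q (W c) d)"
    using local unfolding cyl_def by (metis (mono_tags, lifting) mem_Collect_eq)
  have "compactin (config_topology G \<Sigma>) (configs G \<Sigma>)"
    using compact_config_topology[OF assms(1), of G]
    by (simp add: compact_space_def topspace_config_topology)
  then have "\<exists>\<F>. finite \<F> \<and> \<F> \<subseteq> (\<lambda>c. cyl (W c) c) ` configs G \<Sigma> \<and> configs G \<Sigma> \<subseteq> \<Union>\<F>"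
  proof (rule compactinD)
    show "openin (config_topology G \<Sigma>) U" if "U \<in> (\<lambda>c. cyl (W c) c) ` configs G \<Sigma>" for U
      using that W unfolding cyl_def by (auto intro!: openin_cylinder)
    show "configs G \<Sigma> \<subseteq> \<Union>((\<lambda>c. cyl (W c) c) ` configs G \<Sigma>)"
      by (auto simp: cyl_def)
  qed
  then obtain \<F> where \<F>: "finite \<F>" "\<F> \<subseteq> (\<lambda>c. cyl (W c) c) ` configs G \<Sigma>"
      "configs G \<Sigma> \<subseteq> \<Union>\<F>"
    by (elim exE conjE)
  obtain C where C: "C \<subseteq> configs G \<Sigma>" "finite C" "\<F> = (\<lambda>c. cyl (W c) c) ` C"
    using finite_subset_image[OF \<F>(1,2)] by (elim exE conjE)
  have "Q (\<Union>(W ` C)) d" if d: "d \<in> configs G \<Sigma>" for d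
  proof -
    obtain c where "c \<in> C" "d \<in> cyl (W c) c" using \<F>(3) C(3) d by blast
    then show ?thesis using W C(1) by (intro mono[of "W c" "\<Union>(W ` C)"]) auto
  qed
  then show ?thesis using W C by (intro exI[of _ "\<Union>(W ` C)"]) blast
qed

section \<open>Cellular automata are local\<close>

lemma cellular_automaton_maps_configs:
  assumes "cellular_automaton G \<Sigma> T" "c \<in> configs G \<Sigma>"
  shows "T c \<in> configs G \<Sigma>"
  using assms unfolding cellular_automaton_def continuous_map_def topspace_config_topology
  by auto

lemma configs_extensionality:
  assumes "c \<in> configs G \<Sigma>" "d \<in> configs G \<Sigma>" "\<And>x. x \<in> carrier G \<Longrightarrow> c x = d x"
  shows "c = d"
  using assms unfolding configs_def by (metis PiE_ext)

definition is_memory ::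
    "('a, 'm) monoid_scheme \<Rightarrow> 's set \<Rightarrow> (('a \<Rightarrow> 's) \<Rightarrow> ('a \<Rightarrow> 's)) \<Rightarrow> 'a set \<Rightarrow> bool" where
  "is_memory G \<Sigma> T M \<longleftrightarrow>
     (\<forall>c\<in>configs G \<Sigma>. \<forall>d\<in>configs G \<Sigma>. (\<forall>m\<in>M. c m = d m) \<longrightarrow> T c \<one>\<^bsub>G\<^esub> = T d \<one>\<^bsub>G\<^esub>)"

text \<open>One half of the Curtis--Hedlund--Lyndon theorem: \<open>T c 1\<close> is a continuous function into a
  finite discrete space, hence locally determined by finitely many coordinates of \<open>c\<close>, and by
  compactness globally so.\<close>

lemma finite_memory_exists:
  assumes "group G" "finite \<Sigma>" and ca: "cellular_automaton G \<Sigma> T"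
  obtains M where "M \<subseteq> carrier G" "finite M" "is_memory G \<Sigma> T M"
proof -
  interpret group G by fact
  define Q where "Q N d \<longleftrightarrow> (\<forall>e\<in>configs G \<Sigma>. (\<forall>m\<in>N. d m = e m) \<longrightarrow> T d \<one>\<^bsub>G\<^esub> = T e \<one>\<^bsub>G\<^esub>)" for N d
  have "\<exists>N\<subseteq>carrier G. finite N \<and> (\<forall>d\<in>configs G \<Sigma>. Q N d)"
  proof (rule uniform_finite_set[OF assms(2)])
    fix c assume c: "c \<in> configs G \<Sigma>"
    have "continuous_map (config_topology G \<Sigma>) (discrete_topology \<Sigma>) ((\<lambda>c. c \<one>\<^bsub>G\<^esub>) \<circ> T)"
    proof (rule continuous_map_compose)
      show "continuous_map (config_topology G \<Sigma>) (config_topology G \<Sigma>) T"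
        using ca by (simp add: cellular_automaton_def)
      show "continuous_map (config_topology G \<Sigma>) (discrete_topology \<Sigma>) (\<lambda>c. c \<one>\<^bsub>G\<^esub>)"
        unfolding config_topology_def
        using continuous_map_product_projection[of "\<one>\<^bsub>G\<^esub>" "carrier G" "\<lambda>_. discrete_topology \<Sigma>"]
        by simp
    qed
    moreover have "openin (discrete_topology \<Sigma>) {T c \<one>\<^bsub>G\<^esub>}"
      using cellular_automaton_maps_configs[OF ca c] by (auto simp: configs_def PiE_iff)
    ultimately have "openin (config_topology G \<Sigma>) {d \<in> configs G \<Sigma>. T d \<one>\<^bsub>G\<^esub> = T c \<one>\<^bsub>G\<^esub>}"
      using openin_continuous_map_preimage[of "config_topology G \<Sigma>" "discrete_topology \<Sigma>"
          "(\<lambda>c. c \<one>\<^bsub>G\<^esub>) \<circ> T" "{T c \<one>\<^bsub>G\<^esub>}"]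
      by (simp add: topspace_config_topology)
    then have "\<exists>U. finite {x \<in> carrier G. U x \<noteq> topspace (discrete_topology \<Sigma>)} \<and>
        (\<forall>x\<in>carrier G. openin (discrete_topology \<Sigma>) (U x)) \<and> c \<in> Pi\<^sub>E (carrier G) U \<and>
        Pi\<^sub>E (carrier G) U \<subseteq> {d \<in> configs G \<Sigma>. T d \<one>\<^bsub>G\<^esub> = T c \<one>\<^bsub>G\<^esub>}"
      unfolding config_topology_def openin_product_topology_alt by (rule bspec) (use c in simp)
    then obtain U where U: "finite {x \<in> carrier G. U x \<noteq> \<Sigma>}" "c \<in> Pi\<^sub>E (carrier G) U"
        "Pi\<^sub>E (carrier G) U \<subseteq> {d \<in> configs G \<Sigma>. T d \<one>\<^bsub>G\<^esub> = T c \<one>\<^bsub>G\<^esub>}"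
      unfolding topspace_discrete_topology by (elim exE conjE)
    define N where "N = {x \<in> carrier G. U x \<noteq> \<Sigma>}"
    have N: "T d \<one>\<^bsub>G\<^esub> = T c \<one>\<^bsub>G\<^esub>" if "d \<in> configs G \<Sigma>" "\<forall>x\<in>N. d x = c x" for d
    proof -
      have "d \<in> Pi\<^sub>E (carrier G) U"
      proof (rule PiE_I)
        fix x assume "x \<in> carrier G"
        then show "d x \<in> U x" using that U(2) unfolding N_def configs_def
          by (cases "U x = \<Sigma>") (auto simp: PiE_iff)
      qed (use that in \<open>auto simp: configs_def PiE_iff extensional_def\<close>)
      then show ?thesis using U(3) by auto
    qed
    show "\<exists>N\<subseteq>carrier G. finite N \<and> (\<forall>d\<in>configs G \<Sigma>. (\<forall>x\<in>N. d x = c x) \<longrightarrow> Q N d)"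
    proof (intro exI[of _ N] conjI ballI impI)
      fix d assume d: "d \<in> configs G \<Sigma>" "\<forall>x\<in>N. d x = c x"
      show "Q N d" unfolding Q_def using N d by metis
    qed (use U(1) in \<open>auto simp: N_def\<close>)
  qed (auto simp: Q_def)
  then obtain N where N: "N \<subseteq> carrier G" "finite N" "\<forall>d\<in>configs G \<Sigma>. Q N d"
    by (elim exE conjE)
  have "is_memory G \<Sigma> T N"
    using N(3) unfolding is_memory_def Q_def .
  with N(1,2) show thesis by (rule that)
qed

text \<open>What an observer at the site \<open>a\<close> of \<open>A\<close> sees of \<open>c\<close> when the positions relative to \<open>a\<close> are named
  by elements of \<open>B\<close>.\<close>

definition view ::
    "('a, 'm) monoid_scheme \<Rightarrow> ('b, 'n) monoid_scheme \<Rightarrow> ('b \<Rightarrow> 'a) \<Rightarrow> ('a \<Rightarrow> 's) \<Rightarrow> 'a \<Rightarrow> 'b \<Rightarrow> 's" where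
  "view A B \<phi> c a = (\<lambda>b\<in>carrier B. c (a \<otimes>\<^bsub>A\<^esub> \<phi> b))"

text \<open>Applying the local rule \<open>c \<mapsto> T c 1\<close> of \<open>T\<close> to the view from each site of \<open>A\<close>. Defining \<open>\<phi>\<close> on
  all of \<open>B\<close> rather than on a memory set avoids extracting a rule on finite patterns: only the
  values of \<open>\<phi>\<close> on a memory set influence the result.\<close>

definition transfer ::
    "('a, 'm) monoid_scheme \<Rightarrow> ('b, 'n) monoid_scheme \<Rightarrow> ('b \<Rightarrow> 'a) \<Rightarrow>
     (('b \<Rightarrow> 's) \<Rightarrow> ('b \<Rightarrow> 's)) \<Rightarrow> ('a \<Rightarrow> 's) \<Rightarrow> ('a \<Rightarrow> 's)" where
  "transfer A B \<phi> T c = (\<lambda>a\<in>carrier A. T (view A B \<phi> c a) \<one>\<^bsub>B\<^esub>)"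

lemma view_configs:
  assumes "group A" "\<phi> \<in> carrier B \<rightarrow> carrier A" "c \<in> configs A \<Sigma>" "a \<in> carrier A"
  shows "view A B \<phi> c a \<in> configs B \<Sigma>"
proof -
  interpret group A by fact
  show ?thesis using assms(2-) by (auto simp: view_def configs_def PiE_iff Pi_iff)
qed

lemma transfer_configs:
  assumes "group A" "group B" "\<phi> \<in> carrier B \<rightarrow> carrier A"
    and "cellular_automaton B \<Sigma> T" "c \<in> configs A \<Sigma>"
  shows "transfer A B \<phi> T c \<in> configs A \<Sigma>"
proof -
  interpret B: group B by fact
  have "T (view A B \<phi> c a) \<in> configs B \<Sigma>" if "a \<in> carrier A" for a
    using view_configs[OF assms(1,3,5) that] by (rule cellular_automaton_maps_configs[OF assms(4)])
  then show ?thesis by (auto simp: transfer_def configs_def PiE_iff)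
qed

lemma cellular_automaton_transfer:
  assumes "group A" "group B" and \<phi>: "\<phi> \<in> carrier B \<rightarrow> carrier A"
    and ca: "cellular_automaton B \<Sigma> T"
  shows "cellular_automaton A \<Sigma> (transfer A B \<phi> T)"
  unfolding cellular_automaton_def
proof (intro conjI ballI)
  interpret A: group A by fact
  interpret B: group B by fact
  have "continuous_map (config_topology A \<Sigma>) (discrete_topology \<Sigma>) (\<lambda>c. transfer A B \<phi> T c a)"
    if a: "a \<in> carrier A" for a
  proof -
    have "continuous_map (config_topology A \<Sigma>) (config_topology B \<Sigma>) (\<lambda>c. view A B \<phi> c a)"
      unfolding config_topology_def
    proof (subst continuous_map_componentwise, intro conjI ballI)
      fix b assume b: "b \<in> carrier B"
      then have "a \<otimes>\<^bsub>A\<^esub> \<phi> b \<in> carrier A" using a \<phi> by auto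
      from continuous_map_product_projection[OF this, of "\<lambda>_. discrete_topology \<Sigma>"]
      show "continuous_map (product_topology (\<lambda>_. discrete_topology \<Sigma>) (carrier A))
          (discrete_topology \<Sigma>) (\<lambda>c. view A B \<phi> c a b)"
        using b by (simp add: view_def)
    qed (auto simp: view_def)
    moreover have "continuous_map (config_topology B \<Sigma>) (config_topology B \<Sigma>) T"
      using ca by (simp add: cellular_automaton_def)
    moreover have "continuous_map (config_topology B \<Sigma>) (discrete_topology \<Sigma>) (\<lambda>d. d \<one>\<^bsub>B\<^esub>)"
      unfolding config_topology_def
      using continuous_map_product_projection[of "\<one>\<^bsub>B\<^esub>" "carrier B" "\<lambda>_. discrete_topology \<Sigma>"]
      by simp
    ultimately have "continuous_map (config_topology A \<Sigma>) (discrete_topology \<Sigma>)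
        ((\<lambda>d. d \<one>\<^bsub>B\<^esub>) \<circ> (T \<circ> (\<lambda>c. view A B \<phi> c a)))"
      by (metis continuous_map_compose)
    then show ?thesis using a by (simp add: transfer_def o_def)
  qed
  then show "continuous_map (config_topology A \<Sigma>) (config_topology A \<Sigma>) (transfer A B \<phi> T)"
    by (subst (2) config_topology_def, subst continuous_map_componentwise)
       (auto simp: transfer_def)
  fix g c assume g: "g \<in> carrier A" and "c \<in> configs A \<Sigma>"
  have "view A B \<phi> (shift A g c) a = view A B \<phi> c (inv\<^bsub>A\<^esub> g \<otimes>\<^bsub>A\<^esub> a)" if "a \<in> carrier A" for a
    using that g \<phi> by (auto simp: view_def shift_def A.m_assoc Pi_iff fun_eq_iff)
  then show "transfer A B \<phi> T (shift A g c) = shift A g (transfer A B \<phi> T c)"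
    using g unfolding transfer_def shift_def[of A g "\<lambda>a\<in>carrier A. T (view A B \<phi> c a) \<one>\<^bsub>B\<^esub>"]
    by (intro restrict_ext) simp
qed

text \<open>For \<open>\<phi>\<close> the identity the transferred automaton is \<open>T\<close> itself, since the view from \<open>g\<close> is the
  shift by \<open>g\<^sup>-\<^sup>1\<close>.\<close>

lemma cellular_automaton_eq_transfer:
  assumes "group G" "cellular_automaton G \<Sigma> T" "c \<in> configs G \<Sigma>" "g \<in> carrier G"
  shows "T c g = T (view G G (\<lambda>x. x) c g) \<one>\<^bsub>G\<^esub>"
proof -
  interpret group G by fact
  have "view G G (\<lambda>x. x) c g = shift G (inv\<^bsub>G\<^esub> g) c"
    using assms(4) by (simp add: view_def shift_def)
  then have "T (view G G (\<lambda>x. x) c g) = shift G (inv\<^bsub>G\<^esub> g) (T c)"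
    using assms by (simp add: cellular_automaton_def)
  then show ?thesis using assms(4) by (simp add: shift_def)
qed

text \<open>The comparison between the two groups: equal patterns around \<open>a\<close> and around \<open>b\<close> give equal
  values.\<close>

lemma transfer_eq:
  assumes "group A" "group B" "\<phi> \<in> carrier B \<rightarrow> carrier A"
    and "cellular_automaton B \<Sigma> T" "is_memory B \<Sigma> T M" "M \<subseteq> carrier B"
    and "c \<in> configs A \<Sigma>" "a \<in> carrier A" "d \<in> configs B \<Sigma>" "b \<in> carrier B"
    and "\<And>m. m \<in> M \<Longrightarrow> c (a \<otimes>\<^bsub>A\<^esub> \<phi> m) = d (b \<otimes>\<^bsub>B\<^esub> m)"
  shows "transfer A B \<phi> T c a = T d b"
proof -
  have "view A B \<phi> c a m = view B B (\<lambda>x. x) d b m" if "m \<in> M" for m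
    using that assms(6,11) by (auto simp: view_def)
  moreover have "view A B \<phi> c a \<in> configs B \<Sigma>" "view B B (\<lambda>x. x) d b \<in> configs B \<Sigma>"
    using view_configs[OF assms(1,3,7,8)] view_configs[OF assms(2) _ assms(9,10), of "\<lambda>x. x" B]
    by simp_all
  ultimately have "T (view A B \<phi> c a) \<one>\<^bsub>B\<^esub> = T (view B B (\<lambda>x. x) d b) \<one>\<^bsub>B\<^esub>"
    using assms(5) unfolding is_memory_def by blast
  then show ?thesis
    using cellular_automaton_eq_transfer[OF assms(2,4,9,10)] assms(8) by (simp add: transfer_def)
qed

lemma transfer_cong:
  assumes "group A" "\<phi> \<in> carrier B \<rightarrow> carrier A" "is_memory B \<Sigma> T M" "M \<subseteq> carrier B"
    and "c \<in> configs A \<Sigma>" "c' \<in> configs A \<Sigma>" "a \<in> carrier A"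
    and "\<And>m. m \<in> M \<Longrightarrow> c (a \<otimes>\<^bsub>A\<^esub> \<phi> m) = c' (a \<otimes>\<^bsub>A\<^esub> \<phi> m)"
  shows "transfer A B \<phi> T c a = transfer A B \<phi> T c' a"
proof -
  have "view A B \<phi> c a m = view A B \<phi> c' a m" if "m \<in> M" for m
    using that assms(4,8) by (auto simp: view_def)
  moreover have "view A B \<phi> c a \<in> configs B \<Sigma>" "view A B \<phi> c' a \<in> configs B \<Sigma>"
    using view_configs[OF assms(1,2,5,7)] view_configs[OF assms(1,2,6,7)] by simp_all
  ultimately have "T (view A B \<phi> c a) \<one>\<^bsub>B\<^esub> = T (view A B \<phi> c' a) \<one>\<^bsub>B\<^esub>"
    using assms(3) unfolding is_memory_def by blast
  then show ?thesis using assms(7) by (simp add: transfer_def)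
qed

lemma cellular_automaton_local:
  assumes "group G" "cellular_automaton G \<Sigma> T" "is_memory G \<Sigma> T M" "M \<subseteq> carrier G"
    and "c \<in> configs G \<Sigma>" "d \<in> configs G \<Sigma>" "g \<in> carrier G"
    and "\<And>m. m \<in> M \<Longrightarrow> c (g \<otimes>\<^bsub>G\<^esub> m) = d (g \<otimes>\<^bsub>G\<^esub> m)"
  shows "T c g = T d g"
  using transfer_eq[OF assms(1,1) _ assms(2-5,7,6,7), of "\<lambda>x. x"]
    transfer_eq[OF assms(1,1) _ assms(2-4,5,7,5,7), of "\<lambda>x. x"] assms(8) by simp

section \<open>Post-surjectivity in terms of changes at the identity\<close>

text \<open>The set \<open>N\<close> bounds where \<open>c\<close> has to be altered to obtain an arbitrary value of \<open>T c\<close> at the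
  identity. Keeping the configuration as a separate argument gives the local statement to which
  compactness is applied.\<close>

definition repairs_identity_of ::
    "('a, 'm) monoid_scheme \<Rightarrow> 's set \<Rightarrow> (('a \<Rightarrow> 's) \<Rightarrow> ('a \<Rightarrow> 's)) \<Rightarrow> 'a set \<Rightarrow> ('a \<Rightarrow> 's) \<Rightarrow> bool" where
  "repairs_identity_of G \<Sigma> T N c \<longleftrightarrow>
     (\<forall>s\<in>\<Sigma>. \<exists>c'\<in>configs G \<Sigma>.
        (\<forall>x\<in>carrier G - N. c' x = c x) \<and> T c' = (T c)(\<one>\<^bsub>G\<^esub> := s))"

definition repairs_identity ::
    "('a, 'm) monoid_scheme \<Rightarrow> 's set \<Rightarrow> (('a \<Rightarrow> 's) \<Rightarrow> ('a \<Rightarrow> 's)) \<Rightarrow> 'a set \<Rightarrow> bool" where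
  "repairs_identity G \<Sigma> T N \<longleftrightarrow> (\<forall>c\<in>configs G \<Sigma>. repairs_identity_of G \<Sigma> T N c)"

lemma repairs_identity_of_mono:
  assumes "N \<subseteq> N'" "repairs_identity_of G \<Sigma> T N c"
  shows "repairs_identity_of G \<Sigma> T N' c"
  unfolding repairs_identity_of_def
proof
  fix s assume "s \<in> \<Sigma>"
  then obtain c' where "c' \<in> configs G \<Sigma>" "\<forall>x\<in>carrier G - N. c' x = c x"
      "T c' = (T c)(\<one>\<^bsub>G\<^esub> := s)"
    using assms(2) unfolding repairs_identity_of_def by blast
  then show "\<exists>c'\<in>configs G \<Sigma>. (\<forall>x\<in>carrier G - N'. c' x = c x) \<and> T c' = (T c)(\<one>\<^bsub>G\<^esub> := s)"
    using assms(1) by (intro bexI[of _ c']) auto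
qed

lemma repairs_identity_mono:
  "repairs_identity G \<Sigma> T N \<Longrightarrow> N \<subseteq> N' \<Longrightarrow> repairs_identity G \<Sigma> T N'"
  unfolding repairs_identity_def using repairs_identity_of_mono by blast

lemma configs_update:
  assumes "c \<in> configs G \<Sigma>" "s \<in> \<Sigma>" "g \<in> carrier G"
  shows "c(g := s) \<in> configs G \<Sigma>"
  using assms by (auto simp: configs_def PiE_iff extensional_def)

lemma shift_configs:
  assumes "group G" "g \<in> carrier G" "c \<in> configs G \<Sigma>"
  shows "shift G g c \<in> configs G \<Sigma>"
proof -
  interpret group G by fact
  show ?thesis using assms(2,3) by (auto simp: shift_def configs_def PiE_iff)
qed

lemma shift_inv_shift:
  assumes "group G" "g \<in> carrier G" "c \<in> configs G \<Sigma>"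
  shows "shift G g (shift G (inv\<^bsub>G\<^esub> g) c) = c"
proof -
  interpret group G by fact
  show ?thesis
  proof (rule configs_extensionality[OF _ assms(3)])
    show "shift G g (shift G (inv\<^bsub>G\<^esub> g) c) \<in> configs G \<Sigma>"
      using assms by (intro shift_configs) auto
    fix x assume "x \<in> carrier G"
    then show "shift G g (shift G (inv\<^bsub>G\<^esub> g) c) x = c x"
      using assms(2) by (simp add: shift_def flip: m_assoc)
  qed
qed

lemma asymptotic_trans:
  assumes "asymptotic G c d" "asymptotic G d e"
  shows "asymptotic G c e"
  using finite_UnI[OF assms[unfolded asymptotic_def]] unfolding asymptotic_def
  by (rule rev_finite_subset) auto

text \<open>Equivariance moves a repair at the identity to an arbitrary site \<open>g\<close>, the altered sites
  becoming \<open>g N\<close>.\<close>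

lemma repairs_identity_imp_repairs:
  assumes "group G" "cellular_automaton G \<Sigma> T" "repairs_identity G \<Sigma> T N" "finite N"
    and c: "c \<in> configs G \<Sigma>" and "s \<in> \<Sigma>" and g: "g \<in> carrier G"
  obtains c' where "c' \<in> configs G \<Sigma>" "asymptotic G c' c" "T c' = (T c)(g := s)"
proof -
  interpret group G by fact
  define d where "d = shift G (inv\<^bsub>G\<^esub> g) c"
  have d: "d \<in> configs G \<Sigma>" unfolding d_def using assms by (intro shift_configs) auto
  have dc: "shift G g d = c" unfolding d_def using assms by (intro shift_inv_shift)
  obtain d' where d': "d' \<in> configs G \<Sigma>" "\<forall>x\<in>carrier G - N. d' x = d x"
      "T d' = (T d)(\<one>\<^bsub>G\<^esub> := s)"
    using assms(3,6) d unfolding repairs_identity_def repairs_identity_of_def by blast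
  define c' where "c' = shift G g d'"
  have c': "c' \<in> configs G \<Sigma>" unfolding c'_def using assms d' by (intro shift_configs)
  have T: "T (shift G g e) = shift G g (T e)" if "e \<in> configs G \<Sigma>" for e
    using assms(2) g that by (simp add: cellular_automaton_def)
  have "T c' = (T c)(g := s)"
  proof (rule configs_extensionality)
    show "T c' \<in> configs G \<Sigma>" using assms(2) c' by (rule cellular_automaton_maps_configs)
    show "(T c)(g := s) \<in> configs G \<Sigma>"
      using assms(6) g cellular_automaton_maps_configs[OF assms(2) c] by (intro configs_update)
    fix x assume x: "x \<in> carrier G"
    have "T c x = T d (inv\<^bsub>G\<^esub> g \<otimes>\<^bsub>G\<^esub> x)"
      using T[OF d] dc x by (simp add: shift_def)
    moreover have "T c' x = T d' (inv\<^bsub>G\<^esub> g \<otimes>\<^bsub>G\<^esub> x)"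
      using T[OF d'(1)] x by (simp add: c'_def shift_def)
    moreover have "inv\<^bsub>G\<^esub> g \<otimes>\<^bsub>G\<^esub> x = \<one>\<^bsub>G\<^esub> \<longleftrightarrow> x = g"
      using x g by (metis inv_closed inv_solve_left' l_inv r_one one_closed)
    ultimately show "T c' x = ((T c)(g := s)) x" using d'(3) by simp
  qed
  moreover have "asymptotic G c' c"
    unfolding asymptotic_def
  proof (rule finite_subset)
    show "{x \<in> carrier G. c' x \<noteq> c x} \<subseteq> (\<lambda>x. g \<otimes>\<^bsub>G\<^esub> x) ` N"
    proof clarify
      fix x assume x: "x \<in> carrier G" "c' x \<noteq> c x"
      have "d' (inv\<^bsub>G\<^esub> g \<otimes>\<^bsub>G\<^esub> x) \<noteq> d (inv\<^bsub>G\<^esub> g \<otimes>\<^bsub>G\<^esub> x)"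
        using x unfolding c'_def dc[symmetric] by (simp add: shift_def)
      then have "inv\<^bsub>G\<^esub> g \<otimes>\<^bsub>G\<^esub> x \<in> N" using d'(2) x g by auto
      moreover have "x = g \<otimes>\<^bsub>G\<^esub> (inv\<^bsub>G\<^esub> g \<otimes>\<^bsub>G\<^esub> x)" using x g by (simp flip: m_assoc)
      ultimately show "x \<in> (\<lambda>x. g \<otimes>\<^bsub>G\<^esub> x) ` N" by blast
    qed
  qed (use assms(4) in simp)
  ultimately show thesis using that c' by blast
qed

text \<open>Induction on the finite set of sites where \<open>T c\<close> and the target disagree, repairing one site
  at a time.\<close>

lemma repairs_identity_imp_post_surjective:
  assumes "group G" "cellular_automaton G \<Sigma> T" "repairs_identity G \<Sigma> T N" "finite N"
  shows "post_surjective G \<Sigma> T"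
proof -
  have *: "\<exists>c'\<in>configs G \<Sigma>. asymptotic G c' c \<and> T c' = e"
    if "finite D" "c \<in> configs G \<Sigma>" "e \<in> configs G \<Sigma>" "{x \<in> carrier G. T c x \<noteq> e x} \<subseteq> D"
    for D c e
    using that
  proof (induction D arbitrary: c rule: finite_induct)
    case empty
    then have "T c = e"
      using cellular_automaton_maps_configs[OF assms(2)] by (intro configs_extensionality) auto
    then show ?case using empty by (intro bexI[of _ c]) (auto simp: asymptotic_def)
  next
    case (insert g D)
    show ?case
    proof (cases "g \<in> carrier G")
      case True
      then have "e g \<in> \<Sigma>" using insert.prems by (auto simp: configs_def)
      then obtain c1 where c1: "c1 \<in> configs G \<Sigma>" "asymptotic G c1 c" "T c1 = (T c)(g := e g)"
        using repairs_identity_imp_repairs[OF assms insert.prems(1) _ True] by metis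
      have "{x \<in> carrier G. T c1 x \<noteq> e x} \<subseteq> D" using insert.prems c1(3) by auto
      with insert.IH[OF c1(1) insert.prems(2)] c1(2) show ?thesis
        using asymptotic_trans by blast
    next
      case False
      then have "{x \<in> carrier G. T c x \<noteq> e x} \<subseteq> D" using insert.prems by auto
      then show ?thesis using insert by blast
    qed
  qed
  show ?thesis
    unfolding post_surjective_def by (intro ballI impI *) (auto simp: asymptotic_def)
qed

text \<open>For a single \<open>c\<close> and each of the finitely many symbols, post-surjectivity gives a repair that
  differs from \<open>c\<close> on a finite set; let \<open>D\<close> be the union of these sets. The same changes repair every
  \<open>d\<close> that agrees with \<open>c\<close> on a large enough finite window \<open>W\<close>, as changes on \<open>D\<close> are felt only on
  \<open>D M\<^sup>-\<^sup>1\<close>. So a finite set works locally around each \<open>c\<close>, and compactness makes it uniform.\<close>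

lemma post_surjective_imp_repairs_identity:
  assumes "group G" "finite \<Sigma>" and ca: "cellular_automaton G \<Sigma> T"
    and post: "post_surjective G \<Sigma> T"
  obtains N where "N \<subseteq> carrier G" "finite N" "repairs_identity G \<Sigma> T N"
proof -
  interpret group G by fact
  obtain M where M: "M \<subseteq> carrier G" "finite M" "is_memory G \<Sigma> T M"
    using finite_memory_exists[OF assms(1-3)] .
  have TS: "T e \<in> configs G \<Sigma>" if "e \<in> configs G \<Sigma>" for e
    using cellular_automaton_maps_configs[OF ca that] .
  have "\<exists>N\<subseteq>carrier G. finite N \<and> (\<forall>d\<in>configs G \<Sigma>. repairs_identity_of G \<Sigma> T N d)"
  proof (rule uniform_finite_set[OF assms(2)])
    fix c assume c: "c \<in> configs G \<Sigma>"
    have "\<exists>c'\<in>configs G \<Sigma>. asymptotic G c' c \<and> T c' = (T c)(\<one>\<^bsub>G\<^esub> := s)" if "s \<in> \<Sigma>" for s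
    proof -
      have "asymptotic G (T c) ((T c)(\<one>\<^bsub>G\<^esub> := s))"
        unfolding asymptotic_def by (rule finite_subset[of _ "{\<one>\<^bsub>G\<^esub>}"]) auto
      then show ?thesis
        using post c configs_update[OF TS[OF c] that one_closed]
        unfolding post_surjective_def by blast
    qed
    then obtain p where p: "\<And>s. s \<in> \<Sigma> \<Longrightarrow>
        p s \<in> configs G \<Sigma> \<and> asymptotic G (p s) c \<and> T (p s) = (T c)(\<one>\<^bsub>G\<^esub> := s)"
      by metis
    define D where "D = (\<Union>s\<in>\<Sigma>. {x \<in> carrier G. p s x \<noteq> c x})"
    \<comment> \<open>\<open>K\<close> contains every site where the image can change, and \<open>W\<close> everything visible from \<open>K\<close>.\<close>
    define K where "K = insert \<one>\<^bsub>G\<^esub> ((\<lambda>(x, m). x \<otimes>\<^bsub>G\<^esub> inv\<^bsub>G\<^esub> m) ` (D \<times> M))"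
    define W where "W = D \<union> (\<lambda>(k, m). k \<otimes>\<^bsub>G\<^esub> m) ` (K \<times> M)"
    have D: "finite D" "D \<subseteq> carrier G"
      using p assms(2) by (auto simp: D_def asymptotic_def)
    have K: "finite K" "K \<subseteq> carrier G" using D M by (auto simp: K_def)
    have W: "finite W" "W \<subseteq> carrier G" using D K M by (auto simp: W_def)
    have "repairs_identity_of G \<Sigma> T W d" if d: "d \<in> configs G \<Sigma>" and dW: "\<forall>x\<in>W. d x = c x" for d
      unfolding repairs_identity_of_def
    proof
      fix s assume s: "s \<in> \<Sigma>"
      \<comment> \<open>Graft the repair of \<open>c\<close> onto \<open>d\<close>: on \<open>W\<close> the result is indistinguishable from \<open>p s\<close>.\<close>
      define d' where "d' = (\<lambda>x. if x \<in> D then p s x else d x)"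
      have d': "d' \<in> configs G \<Sigma>"
        using d p[OF s] D(2) by (auto simp: d'_def configs_def PiE_iff extensional_def)
      have ps: "p s x = c x" if "x \<in> carrier G - D" for x
        using that s by (auto simp: D_def)
      have "T d' g = ((T d)(\<one>\<^bsub>G\<^esub> := s)) g" if g: "g \<in> carrier G" for g
      proof (cases "g \<in> K")
        case True
        then have gm: "g \<otimes>\<^bsub>G\<^esub> m \<in> W" if "m \<in> M" for m
          using that by (auto simp: W_def)
        have "d' (g \<otimes>\<^bsub>G\<^esub> m) = p s (g \<otimes>\<^bsub>G\<^esub> m)" if "m \<in> M" for m
          using ps[of "g \<otimes>\<^bsub>G\<^esub> m"] dW gm[OF that] W(2) by (auto simp: d'_def)
        then have "T d' g = T (p s) g"
          using d' p[OF s] g by (intro cellular_automaton_local[OF assms(1) ca M(3,1)]) auto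
        moreover have "T d g = T c g"
          using d c g dW gm by (intro cellular_automaton_local[OF assms(1) ca M(3,1)]) auto
        ultimately show ?thesis using p[OF s] by auto
      next
        case False
        have "g \<otimes>\<^bsub>G\<^esub> m \<notin> D" if m: "m \<in> M" for m
        proof
          assume "g \<otimes>\<^bsub>G\<^esub> m \<in> D"
          then have "(g \<otimes>\<^bsub>G\<^esub> m) \<otimes>\<^bsub>G\<^esub> inv\<^bsub>G\<^esub> m \<in> K" using m by (auto simp: K_def)
          moreover have "(g \<otimes>\<^bsub>G\<^esub> m) \<otimes>\<^bsub>G\<^esub> inv\<^bsub>G\<^esub> m = g"
            using m M g by (metis inv_solve_right m_closed subsetD)
          ultimately show False using False by simp
        qed
        then have "T d' g = T d g"
          using d d' g
          by (intro cellular_automaton_local[OF assms(1) ca M(3,1)]) (auto simp: d'_def)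
        then show ?thesis using False by (auto simp: K_def)
      qed
      then have "T d' = (T d)(\<one>\<^bsub>G\<^esub> := s)"
        using TS d d' s by (intro configs_extensionality configs_update) auto
      then show "\<exists>c'\<in>configs G \<Sigma>. (\<forall>x\<in>carrier G - W. c' x = d x) \<and> T c' = (T d)(\<one>\<^bsub>G\<^esub> := s)"
        using d' by (intro bexI[of _ d']) (auto simp: d'_def W_def)
    qed
    with W show "\<exists>N\<subseteq>carrier G. finite N \<and> (\<forall>d\<in>configs G \<Sigma>. (\<forall>x\<in>N. d x = c x) \<longrightarrow> repairs_identity_of G \<Sigma> T N d)"
      by blast
  qed (fact repairs_identity_of_mono)
  then obtain N where N: "N \<subseteq> carrier G" "finite N" "\<forall>d\<in>configs G \<Sigma>. repairs_identity_of G \<Sigma> T N d"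
    by (elim exE conjE)
  have "repairs_identity G \<Sigma> T N"
    using N(3) unfolding repairs_identity_def .
  with N(1,2) show thesis by (rule that)
qed

section \<open>Transfer along a finite piece of the multiplication table\<close>

text \<open>The set \<open>E\<close> contains the sites where configurations will be changed. Then \<open>K\<close> contains
  all sites where their images can differ, and \<open>F\<close> everything visible from \<open>K\<close>. The identity
  belongs to \<open>K\<close> because repairs concern the value there, even if \<open>E M\<^sup>-\<^sup>1\<close> does not contain it.\<close>

locale local_embedding =
  A: group A + B: group B
  for A :: "('a, 'm) monoid_scheme" and B :: "('b, 'n) monoid_scheme" +
  fixes \<Sigma> :: "'s set" and T :: "('b \<Rightarrow> 's) \<Rightarrow> ('b \<Rightarrow> 's)"
    and M E K F :: "'b set" and \<phi> :: "'b \<Rightarrow> 'a"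
  assumes ca: "cellular_automaton B \<Sigma> T"
    and memory: "is_memory B \<Sigma> T M"
    and M_carrier: "M \<subseteq> carrier B" and E_carrier: "E \<subseteq> carrier B"
    and finite_E: "finite E"
  defines "K \<equiv> insert \<one>\<^bsub>B\<^esub> ((\<lambda>(x, m). x \<otimes>\<^bsub>B\<^esub> inv\<^bsub>B\<^esub> m) ` (E \<times> M))"
    and "F \<equiv> E \<union> M \<union> K \<union> (\<lambda>(k, m). k \<otimes>\<^bsub>B\<^esub> m) ` (K \<times> M)"
  assumes \<phi>_carrier: "\<phi> \<in> carrier B \<rightarrow> carrier A"
    and \<phi>_inj: "inj_on \<phi> F"
    and \<phi>_mult: "\<And>x y. x \<in> F \<Longrightarrow> y \<in> F \<Longrightarrow> x \<otimes>\<^bsub>B\<^esub> y \<in> F \<Longrightarrow> \<phi> (x \<otimes>\<^bsub>B\<^esub> y) = \<phi> x \<otimes>\<^bsub>A\<^esub> \<phi> y"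
begin

abbreviation T' :: "('a \<Rightarrow> 's) \<Rightarrow> ('a \<Rightarrow> 's)" where
  "T' \<equiv> transfer A B \<phi> T"

lemma K_carrier: "K \<subseteq> carrier B"
  using E_carrier M_carrier by (auto simp: K_def)

lemma F_carrier: "F \<subseteq> carrier B"
  using E_carrier M_carrier K_carrier by (auto simp: F_def)

lemma \<phi>_KM:
  assumes "k \<in> K" "m \<in> M"
  shows "k \<otimes>\<^bsub>B\<^esub> m \<in> F" "\<phi> (k \<otimes>\<^bsub>B\<^esub> m) = \<phi> k \<otimes>\<^bsub>A\<^esub> \<phi> m"
proof -
  show "k \<otimes>\<^bsub>B\<^esub> m \<in> F" using assms by (auto simp: F_def)
  then show "\<phi> (k \<otimes>\<^bsub>B\<^esub> m) = \<phi> k \<otimes>\<^bsub>A\<^esub> \<phi> m"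
    using assms by (intro \<phi>_mult) (auto simp: F_def)
qed

lemma \<phi>_one: "\<phi> \<one>\<^bsub>B\<^esub> = \<one>\<^bsub>A\<^esub>"
proof -
  have "\<one>\<^bsub>B\<^esub> \<in> F" by (auto simp: F_def K_def)
  then have "\<phi> \<one>\<^bsub>B\<^esub> = \<phi> \<one>\<^bsub>B\<^esub> \<otimes>\<^bsub>A\<^esub> \<phi> \<one>\<^bsub>B\<^esub>" using \<phi>_mult[of "\<one>\<^bsub>B\<^esub>" "\<one>\<^bsub>B\<^esub>"] by simp
  moreover have "\<phi> \<one>\<^bsub>B\<^esub> \<in> carrier A" using \<phi>_carrier by auto
  ultimately show ?thesis by (metis A.l_cancel_one')
qed

lemma T'_configs: "c \<in> configs A \<Sigma> \<Longrightarrow> T' c \<in> configs A \<Sigma>"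
  using transfer_configs[OF A.group_axioms B.group_axioms \<phi>_carrier ca] .

text \<open>Sites outside \<open>\<phi> K\<close> do not notice changes on \<open>\<phi> E\<close>: if \<open>a \<phi>(m) = \<phi>(x)\<close> with \<open>x \<in> E\<close>, then
  \<open>x m\<^sup>-\<^sup>1\<close> lies in \<open>K\<close> and cancelling \<open>\<phi>(m)\<close> in \<open>\<phi>(x m\<^sup>-\<^sup>1) \<phi>(m) = \<phi>(x)\<close> gives \<open>a = \<phi>(x m\<^sup>-\<^sup>1)\<close>.
  This is what makes control over the finite set \<open>\<phi> K\<close> sufficient in all of \<open>A\<close>.\<close>

lemma T'_off_K:
  assumes "c \<in> configs A \<Sigma>" "c' \<in> configs A \<Sigma>" "\<forall>x\<in>carrier A - \<phi> ` E. c' x = c x"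
    and a: "a \<in> carrier A" "a \<notin> \<phi> ` K"
  shows "T' c' a = T' c a"
proof (rule transfer_cong[OF A.group_axioms \<phi>_carrier memory M_carrier assms(2,1) a(1)])
  fix m assume m: "m \<in> M"
  then have \<phi>m: "\<phi> m \<in> carrier A" using \<phi>_carrier M_carrier by auto
  have "a \<otimes>\<^bsub>A\<^esub> \<phi> m \<notin> \<phi> ` E"
  proof
    assume "a \<otimes>\<^bsub>A\<^esub> \<phi> m \<in> \<phi> ` E"
    then obtain x where x: "x \<in> E" "a \<otimes>\<^bsub>A\<^esub> \<phi> m = \<phi> x" by auto
    define k where "k = x \<otimes>\<^bsub>B\<^esub> inv\<^bsub>B\<^esub> m"
    have k: "k \<in> K" using x m by (auto simp: K_def k_def)
    have "x \<in> carrier B" "m \<in> carrier B" using x m E_carrier M_carrier by auto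
    then have "k \<otimes>\<^bsub>B\<^esub> m = x" by (simp add: k_def B.m_assoc)
    then have "a \<otimes>\<^bsub>A\<^esub> \<phi> m = \<phi> k \<otimes>\<^bsub>A\<^esub> \<phi> m" using \<phi>_KM(2)[OF k m] x by simp
    moreover have "\<phi> k \<in> carrier A" using k K_carrier \<phi>_carrier by auto
    ultimately have "a = \<phi> k" using a(1) \<phi>m by (metis A.right_cancel)
    then show False using a(2) k by auto
  qed
  then show "c' (a \<otimes>\<^bsub>A\<^esub> \<phi> m) = c (a \<otimes>\<^bsub>A\<^esub> \<phi> m)" using assms(3) a(1) \<phi>m by auto
qed

lemma T'_on_K:
  assumes "c \<in> configs A \<Sigma>" "d \<in> configs B \<Sigma>" "\<And>x. x \<in> F \<Longrightarrow> c (\<phi> x) = d x" "k \<in> K"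
  shows "T' c (\<phi> k) = T d k"
proof (rule transfer_eq[OF A.group_axioms B.group_axioms \<phi>_carrier ca memory M_carrier assms(1) _ assms(2)])
  show "\<phi> k \<in> carrier A" "k \<in> carrier B" using assms(4) K_carrier \<phi>_carrier by auto
  fix m assume "m \<in> M"
  then show "c (\<phi> k \<otimes>\<^bsub>A\<^esub> \<phi> m) = d (k \<otimes>\<^bsub>B\<^esub> m)"
    using \<phi>_KM[OF assms(4)] assms(3) by metis
qed

text \<open>Pull a configuration \<open>c\<close> on \<open>A\<close> back along \<open>\<phi>\<close>, repair it over \<open>B\<close>, and copy the repair back
  to \<open>\<phi> E\<close>. Injectivity of \<open>\<phi>\<close> on \<open>F\<close> ensures that the copied configuration corresponds to the
  repaired one on all of \<open>F\<close>.\<close>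

lemma T'_repairs_identity:
  assumes "repairs_identity B \<Sigma> T E"
  shows "repairs_identity A \<Sigma> T' (\<phi> ` E)"
  unfolding repairs_identity_def repairs_identity_of_def
proof (intro ballI)
  fix c s assume c: "c \<in> configs A \<Sigma>" and s: "s \<in> \<Sigma>"
  define d where "d = (\<lambda>b\<in>carrier B. c (\<phi> b))"
  have d: "d \<in> configs B \<Sigma>"
    using c \<phi>_carrier by (auto simp: d_def configs_def PiE_iff Pi_iff)
  obtain d' where d': "d' \<in> configs B \<Sigma>" "\<forall>x\<in>carrier B - E. d' x = d x"
      "T d' = (T d)(\<one>\<^bsub>B\<^esub> := s)"
    using assms d s unfolding repairs_identity_def repairs_identity_of_def by blast
  define c' where "c' = (\<lambda>x. if x \<in> \<phi> ` E then d' (inv_into F \<phi> x) else c x)"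
  have EF: "E \<subseteq> F" by (auto simp: F_def)
  have c'd': "c' (\<phi> x) = d' x" if x: "x \<in> F" for x
  proof (cases "x \<in> E")
    case True
    then show ?thesis using x \<phi>_inj by (simp add: c'_def inv_into_f_f)
  next
    case False
    then have "\<phi> x \<notin> \<phi> ` E" using x EF \<phi>_inj by (metis inj_on_image_mem_iff)
    then show ?thesis using d'(2) False x F_carrier by (auto simp: c'_def d_def)
  qed
  have c': "c' \<in> configs A \<Sigma>"
  proof -
    have "c' x \<in> \<Sigma>" if "x \<in> carrier A" for x
    proof (cases "x \<in> \<phi> ` E")
      case True
      then obtain y where y: "y \<in> E" "x = \<phi> y" by auto
      then have "y \<in> F" "y \<in> carrier B" using EF E_carrier by auto
      then show ?thesis using c'd'[of y] y(2) d'(1) by (auto simp: configs_def PiE_iff)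
    qed (use that c in \<open>auto simp: c'_def configs_def PiE_iff\<close>)
    moreover have "c' \<in> extensional (carrier A)"
      using c E_carrier \<phi>_carrier
      by (auto simp: c'_def configs_def PiE_iff extensional_def)
    ultimately show ?thesis by (auto simp: configs_def PiE_iff)
  qed
  have off: "\<forall>x\<in>carrier A - \<phi> ` E. c' x = c x" by (auto simp: c'_def)
  have "T' c' a = ((T' c)(\<one>\<^bsub>A\<^esub> := s)) a" if a: "a \<in> carrier A" for a
  proof (cases "a \<in> \<phi> ` K")
    case True
    then obtain k where k: "k \<in> K" "a = \<phi> k" by auto
    have dF: "c (\<phi> x) = d x" if "x \<in> F" for x using that F_carrier by (auto simp: d_def)
    have "T' c' a = T d' k" using T'_on_K[OF c' d'(1) c'd' k(1)] k(2) by simp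
    moreover have "T' c a = T d k"
      using T'_on_K[OF c d dF k(1)] k(2) by simp
    moreover have "a = \<one>\<^bsub>A\<^esub> \<longleftrightarrow> k = \<one>\<^bsub>B\<^esub>"
    proof -
      have "k \<in> F" "\<one>\<^bsub>B\<^esub> \<in> F" using k(1) by (auto simp: F_def K_def)
      then show ?thesis using \<phi>_inj \<phi>_one k(2) by (metis inj_on_eq_iff)
    qed
    ultimately show ?thesis using d'(3) by simp
  next
    case False
    moreover from this have "a \<noteq> \<one>\<^bsub>A\<^esub>" using \<phi>_one by (force simp: K_def)
    ultimately show ?thesis using T'_off_K[OF c c' off a] by simp
  qed
  then have "T' c' = (T' c)(\<one>\<^bsub>A\<^esub> := s)"
    using c c' s by (intro configs_extensionality[of _ A \<Sigma>] configs_update T'_configs) auto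
  then show "\<exists>c'\<in>configs A \<Sigma>. (\<forall>x\<in>carrier A - \<phi> ` E. c' x = c x) \<and> T' c' = (T' c)(\<one>\<^bsub>A\<^esub> := s)"
    using c' off by blast
qed

text \<open>A pair violating pre-injectivity over \<open>B\<close> is copied to \<open>\<phi> F\<close>, and both copies are filled up
  with one common symbol elsewhere, so that they remain asymptotic.\<close>

lemma T'_not_pre_injective:
  assumes c: "c \<in> configs B \<Sigma>" and d: "d \<in> configs B \<Sigma>" and "c \<noteq> d" "T c = T d"
    and E: "{x \<in> carrier B. c x \<noteq> d x} \<subseteq> E"
  shows "\<not> pre_injective A \<Sigma> T'"
proof
  assume pre: "pre_injective A \<Sigma> T'"
  define push where "push e = (\<lambda>a\<in>carrier A.
    if a \<in> \<phi> ` F then e (inv_into F \<phi> a) else c \<one>\<^bsub>B\<^esub>)" for e :: "'b \<Rightarrow> 's"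
  have push_\<phi>: "push e (\<phi> x) = e x" if "x \<in> F" for e x
    using that F_carrier \<phi>_carrier \<phi>_inj by (auto simp: push_def)
  have push: "push e \<in> configs A \<Sigma>" if "e \<in> configs B \<Sigma>" for e
    using that c F_carrier \<phi>_inj by (auto simp: push_def configs_def PiE_iff)
  have off: "\<forall>x\<in>carrier A - \<phi> ` E. push c x = push d x"
  proof
    fix x assume x: "x \<in> carrier A - \<phi> ` E"
    show "push c x = push d x"
    proof (cases "x \<in> \<phi> ` F")
      case True
      then obtain y where y: "y \<in> F" "x = \<phi> y" by auto
      then have "c y = d y" using x E F_carrier by auto
      then show ?thesis using y push_\<phi> by simp
    qed (auto simp: push_def)
  qed
  have "T' (push c) = T' (push d)"
  proof (rule configs_extensionality)
    show "T' (push c) \<in> configs A \<Sigma>" "T' (push d) \<in> configs A \<Sigma>"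
      using push c d by (auto intro: T'_configs)
    fix a assume a: "a \<in> carrier A"
    show "T' (push c) a = T' (push d) a"
    proof (cases "a \<in> \<phi> ` K")
      case True
      then obtain k where k: "k \<in> K" "a = \<phi> k" by auto
      then show ?thesis
        using T'_on_K[OF push[OF c] c push_\<phi> k(1)] T'_on_K[OF push[OF d] d push_\<phi> k(1)] assms(4)
        by simp
    next
      case False
      then show ?thesis using T'_off_K[OF push[OF d] push[OF c] off a] by simp
    qed
  qed
  moreover have "asymptotic A (push c) (push d)"
    unfolding asymptotic_def by (rule finite_subset[of _ "\<phi> ` E"]) (use off finite_E in auto)
  ultimately have eq: "push c = push d"
    using pre push c d unfolding pre_injective_def by blast
  have "c x = d x" if x: "x \<in> carrier B" for x
  proof (rule ccontr)
    assume "c x \<noteq> d x"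
    then have "x \<in> F" using x E by (auto simp: F_def)
    then show False using push_\<phi>[of x c] push_\<phi>[of x d] eq \<open>c x \<noteq> d x\<close> by simp
  qed
  then show False using configs_extensionality[OF c d] \<open>c \<noteq> d\<close> by blast
qed

end

text \<open>Mal'cev's local embeddability, for the class consisting of the single group \<open>A\<close>.\<close>

definition locally_embeds ::
    "('b, 'n) monoid_scheme \<Rightarrow> ('a, 'm) monoid_scheme \<Rightarrow> bool" where
  "locally_embeds B A \<longleftrightarrow> (\<forall>F\<subseteq>carrier B. finite F \<longrightarrow>
     (\<exists>\<phi>\<in>carrier B \<rightarrow> carrier A. inj_on \<phi> F \<and>
        (\<forall>x\<in>F. \<forall>y\<in>F. x \<otimes>\<^bsub>B\<^esub> y \<in> F \<longrightarrow> \<phi> (x \<otimes>\<^bsub>B\<^esub> y) = \<phi> x \<otimes>\<^bsub>A\<^esub> \<phi> y)))"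

text \<open>A counterexample over \<open>B\<close> involves a finite part of the multiplication table of \<open>B\<close> only, so it
  can be copied to \<open>A\<close>.\<close>

theorem dual_surjunctive_locally_embeds:
  assumes "group A" "group B" "locally_embeds B A" "dual_surjunctive A"
  shows "dual_surjunctive B"
  unfolding dual_surjunctive_def
proof (intro allI impI, rule ccontr)
  interpret A: group A by fact
  interpret B: group B by fact
  fix \<Sigma> :: "nat set" and T
  assume fin: "finite \<Sigma>" and ca: "cellular_automaton B \<Sigma> T" and post: "post_surjective B \<Sigma> T"
    and "\<not> pre_injective B \<Sigma> T"
  then obtain c d where cd: "c \<in> configs B \<Sigma>" "d \<in> configs B \<Sigma>" "c \<noteq> d" "T c = T d"
      "finite {x \<in> carrier B. c x \<noteq> d x}"
    unfolding pre_injective_def asymptotic_def by blast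
  obtain M where M: "M \<subseteq> carrier B" "finite M" "is_memory B \<Sigma> T M"
    using finite_memory_exists[OF assms(2) fin ca] .
  obtain N where N: "N \<subseteq> carrier B" "finite N" "repairs_identity B \<Sigma> T N"
    using post_surjective_imp_repairs_identity[OF assms(2) fin ca post] .
  define E where "E = N \<union> {x \<in> carrier B. c x \<noteq> d x}"
  define K where "K = insert \<one>\<^bsub>B\<^esub> ((\<lambda>(x, m). x \<otimes>\<^bsub>B\<^esub> inv\<^bsub>B\<^esub> m) ` (E \<times> M))"
  define F where "F = E \<union> M \<union> K \<union> (\<lambda>(k, m). k \<otimes>\<^bsub>B\<^esub> m) ` (K \<times> M)"
  have E: "E \<subseteq> carrier B" "finite E" using N cd(5) by (auto simp: E_def)
  have K: "K \<subseteq> carrier B" "finite K" using E M by (auto simp: K_def)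
  have "F \<subseteq> carrier B" "finite F" using E M K by (auto simp: F_def)
  then obtain \<phi> where \<phi>: "\<phi> \<in> carrier B \<rightarrow> carrier A" "inj_on \<phi> F"
      "\<And>x y. x \<in> F \<Longrightarrow> y \<in> F \<Longrightarrow> x \<otimes>\<^bsub>B\<^esub> y \<in> F \<Longrightarrow> \<phi> (x \<otimes>\<^bsub>B\<^esub> y) = \<phi> x \<otimes>\<^bsub>A\<^esub> \<phi> y"
    using assms(3) unfolding locally_embeds_def by metis
  interpret local_embedding A B \<Sigma> T M E K F \<phi>
    by unfold_locales (use ca M E \<phi> in \<open>auto simp: K_def F_def\<close>)
  have caA: "cellular_automaton A \<Sigma> T'"
    using assms(1,2) \<phi>(1) ca by (rule cellular_automaton_transfer)
  have "repairs_identity A \<Sigma> T' (\<phi> ` E)"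
    by (intro T'_repairs_identity repairs_identity_mono[OF N(3)]) (auto simp: E_def)
  then have "post_surjective A \<Sigma> T'"
    using repairs_identity_imp_post_surjective[OF assms(1) caA] E(2) by blast
  moreover have "\<not> pre_injective A \<Sigma> T'"
    by (rule T'_not_pre_injective[OF cd(1-4)]) (auto simp: E_def)
  ultimately show False
    using assms(4) fin caA unfolding dual_surjunctive_def by blast
qed

section \<open>Elementary equivalence yields local embeddings\<close>

fun conjunction :: "grp_formula list \<Rightarrow> grp_formula" where
  "conjunction [] = Eq (Var 0) (Var 0)"
| "conjunction (\<phi> # \<phi>s) = Conj \<phi> (conjunction \<phi>s)"

lemma satisfies_conjunction:
  "satisfies G v (conjunction \<phi>s) \<longleftrightarrow> (\<forall>\<phi>\<in>set \<phi>s. satisfies G v \<phi>)"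
  by (induction \<phi>s) auto

lemma free_vars_conjunction:
  "free_vars (conjunction \<phi>s) \<subseteq> insert 0 (\<Union>\<phi>\<in>set \<phi>s. free_vars \<phi>)"
  by (induction \<phi>s) auto

text \<open>The quantifier over variable \<open>n\<close> is placed innermost, so that the induction on \<open>n\<close> changes only
  the matrix of the formula.\<close>

primrec exists_below :: "nat \<Rightarrow> grp_formula \<Rightarrow> grp_formula" where
  "exists_below 0 \<phi> = \<phi>"
| "exists_below (Suc n) \<phi> = exists_below n (Exists n \<phi>)"

lemma free_vars_exists_below:
  "free_vars (exists_below n \<phi>) = free_vars \<phi> - {..<n}"
  by (induction n arbitrary: \<phi>) (auto simp: less_Suc_eq)

lemma satisfies_exists_below:
  "satisfies G v (exists_below n \<phi>) \<longleftrightarrow>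
     (\<exists>w. (\<forall>i<n. w i \<in> carrier G) \<and> (\<forall>i\<ge>n. w i = v i) \<and> satisfies G w \<phi>)"
proof (induction n arbitrary: \<phi>)
  case 0
  have "w = v" if "\<forall>i. w i = v i" for w using that by auto
  then show ?case by auto
next
  case (Suc n)
  have "(\<exists>w. (\<forall>i<n. w i \<in> carrier G) \<and> (\<forall>i\<ge>n. w i = v i) \<and>
          (\<exists>a\<in>carrier G. satisfies G (w(n := a)) \<phi>)) \<longleftrightarrow>
        (\<exists>w. (\<forall>i<Suc n. w i \<in> carrier G) \<and> (\<forall>i\<ge>Suc n. w i = v i) \<and> satisfies G w \<phi>)"
    (is "?L \<longleftrightarrow> ?R")
  proof
    assume ?L
    then obtain w a where "\<forall>i<n. w i \<in> carrier G" "\<forall>i\<ge>n. w i = v i" "a \<in> carrier G"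
        "satisfies G (w(n := a)) \<phi>" by blast
    then show ?R by (intro exI[of _ "w(n := a)"]) auto
  next
    assume ?R
    then obtain w where "\<forall>i<Suc n. w i \<in> carrier G" "\<forall>i\<ge>Suc n. w i = v i" "satisfies G w \<phi>"
      by blast
    then show ?L by (intro exI[of _ "w(n := v n)"]) (auto intro!: bexI[of _ "w n"])
  qed
  then show ?case by (simp add: Suc.IH)
qed

text \<open>With the \<open>i\<close>-th variable standing for \<open>xs ! i\<close>, these literals state that the entries of \<open>xs\<close> are
  distinct and record the products that stay in \<open>xs\<close>.\<close>

definition table_literals :: "('b, 'n) monoid_scheme \<Rightarrow> 'b list \<Rightarrow> grp_formula list" where
  "table_literals G xs =
     [Neg (Eq (Var i) (Var j)). i \<leftarrow> [0..<length xs], j \<leftarrow> [0..<i]] @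
     [Eq (Mult (Var i) (Var j)) (Var k). i \<leftarrow> [0..<length xs], j \<leftarrow> [0..<length xs],
        k \<leftarrow> [0..<length xs], xs ! i \<otimes>\<^bsub>G\<^esub> xs ! j = xs ! k]"

lemma satisfies_table_literals:
  "(\<forall>\<phi>\<in>set (table_literals G xs). satisfies H w \<phi>) \<longleftrightarrow>
     inj_on w {..<length xs} \<and>
     (\<forall>i<length xs. \<forall>j<length xs. \<forall>k<length xs.
        xs ! i \<otimes>\<^bsub>G\<^esub> xs ! j = xs ! k \<longrightarrow> w i \<otimes>\<^bsub>H\<^esub> w j = w k)"
proof -
  have "inj_on w {..<n} \<longleftrightarrow> (\<forall>i<n. \<forall>j<i. w i \<noteq> w j)" (is "?L \<longleftrightarrow> ?R") for n :: nat
  proof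
    assume ?L
    show ?R
    proof (intro allI impI notI)
      fix i j assume "i < n" "j < i" "w i = w j"
      then have "i = j" using \<open>?L\<close> by (intro inj_onD[of w "{..<n}" i j]) auto
      then show False using \<open>j < i\<close> by simp
    qed
  next
    assume R: ?R
    show ?L
    proof (rule inj_onI)
      fix i j assume "i \<in> {..<n}" "j \<in> {..<n}" "w i = w j"
      then show "i = j" using R[rule_format, of i j] R[rule_format, of j i]
        by (cases i j rule: linorder_cases) auto
    qed
  qed
  moreover have "(\<forall>\<phi>\<in>set (table_literals G xs). satisfies H w \<phi>) \<longleftrightarrow>
      (\<forall>i<length xs. \<forall>j<i. w i \<noteq> w j) \<and>
      (\<forall>i<length xs. \<forall>j<length xs. \<forall>k<length xs.
        xs ! i \<otimes>\<^bsub>G\<^esub> xs ! j = xs ! k \<longrightarrow> w i \<otimes>\<^bsub>H\<^esub> w j = w k)"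
    unfolding table_literals_def set_append ball_Un
    by (intro arg_cong2[of _ _ _ _ "(\<and>)"]) auto
  ultimately show ?thesis by simp
qed

lemma free_vars_table_literals:
  assumes "\<phi> \<in> set (table_literals G xs)"
  shows "free_vars \<phi> \<subseteq> {..<length xs}"
  using assms by (auto simp: table_literals_def)

text \<open>The conjunction of the literals for \<open>F\<close>, existentially closed, holds in \<open>B\<close> by taking the
  elements of \<open>F\<close> themselves as witnesses. Witnesses in \<open>A\<close> define \<open>\<phi>\<close> on \<open>F\<close>.\<close>

lemma elementarily_equivalent_imp_locally_embeds:
  fixes A :: "('a, 'm) monoid_scheme" and B :: "('b, 'n) monoid_scheme"
  assumes "group A" "group B" "elementarily_equivalent A B"
  shows "locally_embeds B A"
  unfolding locally_embeds_def
proof (intro allI impI)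
  interpret A: group A by fact
  interpret B: group B by fact
  fix F assume F: "F \<subseteq> carrier B" "finite F"
  \<comment> \<open>Adding the identity makes the list nonempty; variable 0, which occurs in the empty
    conjunction, is then among the quantified ones.\<close>
  obtain xs where xs: "set xs = insert \<one>\<^bsub>B\<^esub> F" "distinct xs"
    using F(2) finite_distinct_list[of "insert \<one>\<^bsub>B\<^esub> F"] by auto
  define n where "n = length xs"
  have n: "0 < n" using xs(1) by (cases xs) (auto simp: n_def)
  have xs_carrier: "xs ! i \<in> carrier B" if "i < n" for i
    using that xs(1) F(1) nth_mem[of i xs] by (auto simp: n_def)
  define \<theta> where "\<theta> = exists_below n (conjunction (table_literals B xs))"
  have "(\<Union>\<phi>\<in>set (table_literals B xs). free_vars \<phi>) \<subseteq> {..<n}"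
    unfolding n_def by (intro UN_least free_vars_table_literals)
  then have "free_vars (conjunction (table_literals B xs)) \<subseteq> {..<n}"
    using n by (intro subset_trans[OF free_vars_conjunction]) simp
  then have "sentence \<theta>"
    unfolding sentence_def \<theta>_def free_vars_exists_below by simp
  moreover have "holds_in B \<theta>"
    unfolding holds_in_def \<theta>_def satisfies_exists_below satisfies_conjunction
      satisfies_table_literals
  proof (intro allI impI)
    fix v :: "nat \<Rightarrow> 'b"
    define w where "w i = (if i < n then xs ! i else v i)" for i
    have "inj_on w {..<length xs}"
      using xs(2) by (auto simp: inj_on_def w_def n_def nth_eq_iff_index_eq)
    then show "\<exists>w. (\<forall>i<n. w i \<in> carrier B) \<and> (\<forall>i\<ge>n. w i = v i) \<and> inj_on w {..<length xs} \<and>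
        (\<forall>i<length xs. \<forall>j<length xs. \<forall>k<length xs.
          xs ! i \<otimes>\<^bsub>B\<^esub> xs ! j = xs ! k \<longrightarrow> w i \<otimes>\<^bsub>B\<^esub> w j = w k)"
      using xs_carrier by (intro exI[of _ w]) (auto simp: w_def n_def)
  qed
  ultimately have "holds_in A \<theta>"
    using assms(3) unfolding elementarily_equivalent_def by blast
  then have "satisfies A (\<lambda>_. \<one>\<^bsub>A\<^esub>) \<theta>" unfolding holds_in_def by auto
  then obtain w where w: "\<And>i. i < n \<Longrightarrow> w i \<in> carrier A" "inj_on w {..<n}"
      "\<And>i j k. i < n \<Longrightarrow> j < n \<Longrightarrow> k < n \<Longrightarrow> xs ! i \<otimes>\<^bsub>B\<^esub> xs ! j = xs ! k \<Longrightarrow> w i \<otimes>\<^bsub>A\<^esub> w j = w k"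
    unfolding \<theta>_def satisfies_exists_below satisfies_conjunction satisfies_table_literals n_def
    by metis
  have "\<exists>i<n. xs ! i = x" if "x \<in> F" for x
    using that xs(1) by (metis in_set_conv_nth insertCI n_def)
  then obtain ix where ix: "\<And>x. x \<in> F \<Longrightarrow> ix x < n \<and> xs ! ix x = x" by metis
  define \<phi> where "\<phi> x = (if x \<in> F then w (ix x) else \<one>\<^bsub>A\<^esub>)" for x
  have "inj_on \<phi> F"
  proof (rule inj_onI)
    fix x y assume xy: "x \<in> F" "y \<in> F" "\<phi> x = \<phi> y"
    then have "ix x = ix y" using w(2) ix by (auto simp: \<phi>_def inj_on_def)
    then show "x = y" using ix xy by metis
  qed
  moreover have "\<phi> \<in> carrier B \<rightarrow> carrier A" using w(1) ix by (auto simp: \<phi>_def)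
  moreover have "\<phi> (x \<otimes>\<^bsub>B\<^esub> y) = \<phi> x \<otimes>\<^bsub>A\<^esub> \<phi> y" if "x \<in> F" "y \<in> F" "x \<otimes>\<^bsub>B\<^esub> y \<in> F" for x y
    using that ix w(3)[of "ix x" "ix y" "ix (x \<otimes>\<^bsub>B\<^esub> y)"] by (simp add: \<phi>_def)
  ultimately show "\<exists>\<phi>\<in>carrier B \<rightarrow> carrier A. inj_on \<phi> F \<and>
      (\<forall>x\<in>F. \<forall>y\<in>F. x \<otimes>\<^bsub>B\<^esub> y \<in> F \<longrightarrow> \<phi> (x \<otimes>\<^bsub>B\<^esub> y) = \<phi> x \<otimes>\<^bsub>A\<^esub> \<phi> y)"
    by blast
qed

theorem corollary3p11:
  fixes A :: "('a, 'm) monoid_scheme" and B :: "('b, 'n) monoid_scheme"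
  assumes "group A" and "group B"
    and "elementarily_equivalent A B"
    and "dual_surjunctive A"
  shows "dual_surjunctive B"
  using dual_surjunctive_locally_embeds[OF assms(1,2) _ assms(4)]
    elementarily_equivalent_imp_locally_embeds[OF assms(1-3)] by blast

end
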